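(* Suppose that $(G,X)$ is a second-countable transformation group. Let $W$ be a compact neighbourhood of $z\in X$, $K$ a compact subset of $G$, and $U$ an open neighbourhood of $\phi_z^{-1}(W)$ in $G$. Let $(x_n)_{n\geq 1}$ be a sequence in $X$ such that $G\cdot x_n\to G\cdot z$ and $G\cdot z$ is the unique limit of $(G\cdot x_n)_{n\geq 1}$ in $X/G$. Then there exists $n_0$ such that for every $n\geq n_0$ and every $s\in\phi_{x_n}^{-1}(W)$ there exists $r\in\phi_z^{-1}(W)$ such that $Ks\cap\phi_{x_n}^{-1}(W)\subset Ur^{-1}s$.
   Context: A transformation group $(G,X)$ consists of a locally compact Hausdorff group $G$ and a locally compact Hausdorff space $X$ with a jointly continuous action $G\times X\to X$, $(s,x)\mapsto s\cdot x$. It is second countable if both $G$ and $X$ are. $G\cdot x=\{s\cdot x:s\in G\}$ is the orbit of $x$ and $X/G$ is the orbit space with the quotient topology. For $x\in X$, $\phi_x:G\to G\cdot x$ is $\phi_x(s)=s\cdot x$, so $\phi_x^{-1}(W)=\{s\in G:s\cdot x\in W\}$ for $W\subset X$.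
   Formalization: Uniqueness of the limit is taken for subsequences too: no subsequence of (G·x_n) converges in X/G to an orbit other than G·z. If only limits of the whole sequence are excluded, the claim fails, since a subsequence may also converge to another orbit that meets W. *)

theory Defs
  imports "HOL-Analysis.Analysis" "HOL-Algebra.Group_Action" "HOL-Algebra.Coset"
begin

locale topological_group = group G for G (structure) +
  fixes TG :: "'a topology"
  assumes topspace_group: "topspace TG = carrier G"
    and continuous_mult: "continuous_map (prod_topology TG TG) TG (\<lambda>(s, t). s \<otimes> t)"
    and continuous_inv: "continuous_map TG TG (\<lambda>s. inv s)"

text \<open>
  The action of \<open>s\<close> on \<open>x\<close> is \<open>\<phi> s x\<close>.  The library's \<open>group_action\<close> makes every \<open>\<phi> s\<close> a
  bijection of \<open>topspace X\<close>, extensional (\<open>undefined\<close>) outside it.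
\<close>

locale transformation_group =
  topological_group G TG + group_action G "topspace X" \<phi>
  for G (structure) and TG :: "'a topology" and X :: "'x topology" and \<phi> +
  assumes locally_compact_group: "locally_compact_space TG"
    and Hausdorff_group: "Hausdorff_space TG"
    and locally_compact_base: "locally_compact_space X"
    and Hausdorff_base: "Hausdorff_space X"
    and continuous_action: "continuous_map (prod_topology TG X) X (\<lambda>(s, x). \<phi> s x)"

locale second_countable_transformation_group = transformation_group +
  assumes second_countable_group: "second_countable TG"
    and second_countable_base: "second_countable X"

definition orbit_preimage ::
    "('a, 'm) monoid_scheme \<Rightarrow> ('a \<Rightarrow> 'x \<Rightarrow> 'x) \<Rightarrow> 'x \<Rightarrow> 'x set \<Rightarrow> 'a set"
  where "orbit_preimage G \<phi> x W = {s \<in> carrier G. \<phi> s x \<in> W}"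

definition orbit_space ::
    "('a, 'm) monoid_scheme \<Rightarrow> 'x topology \<Rightarrow> ('a \<Rightarrow> 'x \<Rightarrow> 'x) \<Rightarrow> 'x set topology"
  where "orbit_space G X \<phi> = topology (\<lambda>V. V \<subseteq> orbits G (topspace X) \<phi> \<and>
           openin X {x \<in> topspace X. orbit G \<phi> x \<in> V})"

lemma openin_orbit_space:
  "openin (orbit_space G X \<phi>) V \<longleftrightarrow>
     V \<subseteq> orbits G (topspace X) \<phi> \<and> openin X {x \<in> topspace X. orbit G \<phi> x \<in> V}"
proof -
  let ?P = "\<lambda>V. {x \<in> topspace X. orbit G \<phi> x \<in> V}"
  have int: "?P (S \<inter> T) = ?P S \<inter> ?P T" for S T by auto
  have un: "?P (\<Union>K) = \<Union>(?P ` K)" for K by auto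
  have "istopology (\<lambda>V. V \<subseteq> orbits G (topspace X) \<phi> \<and> openin X (?P V))"
    unfolding istopology_def int un by (auto intro!: openin_Int openin_Union)
  then show ?thesis
    unfolding orbit_space_def by (simp add: topology_inverse')
qed

lemma topspace_orbit_space: "topspace (orbit_space G X \<phi>) = orbits G (topspace X) \<phi>"
proof -
  have "{x \<in> topspace X. orbit G \<phi> x \<in> orbits G (topspace X) \<phi>} = topspace X"
    by (auto simp: orbits_def)
  then have "openin (orbit_space G X \<phi>) (orbits G (topspace X) \<phi>)"
    by (simp add: openin_orbit_space)
  then show ?thesis
    by (metis openin_orbit_space openin_subset openin_topspace subset_antisym)
qed

lemma quotient_map_orbit: "quotient_map X (orbit_space G X \<phi>) (orbit G \<phi>)"
  unfolding quotient_map_def topspace_orbit_space openin_orbit_space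
  by (auto simp: orbits_def)

text \<open>
  The orbit space need not be Hausdorff, and a subsequence may have limits which the whole sequence
  does not have.  In the theorem, "\<open>G\<cdot>z\<close> is the unique limit of \<open>(G\<cdot>x\<^sub>n)\<close>" is read as: no
  subsequence of \<open>(G\<cdot>x\<^sub>n)\<close>, in particular not the sequence itself, converges to an orbit other
  than \<open>G\<cdot>z\<close>.  Excluding other limits of the whole sequence only would be strictly weaker, and
  the conclusion does not follow from it: a free flow may have orbits that approach \<open>G\<cdot>z\<close> for all
  \<open>n\<close>, but for even \<open>n\<close> also pass near a further orbit, which \<open>W\<close> is free to meet.
\<close>

end

theory Submission
  imports Defs
begin

text \<open>
  If the claim fails, it fails with some \<open>s\<^sub>n\<close> for infinitely many \<open>n\<close>. Along a subsequence the points
  \<open>s\<^sub>n\<cdot>x\<^sub>n\<close> of the compact set \<open>W\<close> converge to some \<open>y \<in> W\<close>, and \<open>y\<close> lies in \<open>G\<cdot>z\<close> because no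
  subsequence of the orbits has another limit, say \<open>y = r\<cdot>z\<close>. Every \<open>k \<in> K\<close> with \<open>k\<cdot>y \<in> W\<close> has
  \<open>k r \<in> U\<close>. As \<open>K\<close> is compact, this persists when \<open>y\<close> is replaced by a point \<open>v\<close> near \<open>y\<close>; taking
  \<open>v = s\<^sub>n\<cdot>x\<^sub>n\<close> shows that \<open>r\<close> serves for \<open>s\<^sub>n\<close> after all.
\<close>

text \<open>A countable neighbourhood base at \<open>l\<close> can be made decreasing by finite
  intersections. Choosing ever later indices whose terms enter these sets one after another turns
  the cluster point \<open>l\<close> into the limit of a subsequence.\<close>

lemma first_countable_convergent_subsequence:
  fixes f :: "nat \<Rightarrow> 'a"
  assumes fc: "first_countable X" and l: "l \<in> topspace X"
    and freq: "\<And>V. openin X V \<Longrightarrow> l \<in> V \<Longrightarrow> \<exists>\<^sub>F n in sequentially. f n \<in> V"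
  obtains r :: "nat \<Rightarrow> nat" where "strict_mono r" "limitin X (f \<circ> r) l sequentially"
proof -
  obtain \<B> where \<B>: "countable \<B>" "\<And>V. V \<in> \<B> \<Longrightarrow> openin X V"
    and base: "\<And>V. openin X V \<Longrightarrow> l \<in> V \<Longrightarrow> \<exists>B\<in>\<B>. l \<in> B \<and> B \<subseteq> V"
    using fc l unfolding first_countable_def by metis
  define \<C> where "\<C> = {B \<in> \<B>. l \<in> B}"
  \<comment> \<open>\<open>from_nat_into\<close> enumerates only nonempty countable sets. If
    \<open>\<C>\<close> is finite, the enumeration merely repeats members.\<close>
  have "\<C> \<noteq> {}"
    using base[OF openin_topspace l] by (auto simp: \<C>_def)
  moreover have "countable \<C>"
    unfolding \<C>_def by (intro countable_subset[OF _ \<B>(1)]) auto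
  ultimately have \<C>: "range (from_nat_into \<C>) = \<C>"
    by (rule range_from_nat_into)
  \<comment> \<open>A point of \<open>A i\<close> lies in all of the first \<open>i + 1\<close>
    enumerated base sets, so a term chosen in \<open>A i\<close> stays in the \<open>j\<close>-th
    one for every \<open>i \<ge> j\<close>.\<close>
  define A where "A i = (\<Inter>j\<le>i. from_nat_into \<C> j)" for i
  have mem: "from_nat_into \<C> j \<in> \<C>" for j
    using \<C> by blast
  have A: "openin X (A i)" "l \<in> A i" for i
    unfolding A_def using mem \<B>(2) by (auto simp: \<C>_def intro!: openin_Inter)
  have later: "\<exists>n>m. f n \<in> A i" for m i
    using freq[OF A] by (meson Suc_le_lessD frequently_sequentially)
  have "\<exists>r. \<forall>i. f (r i) \<in> A i \<and> r i < r (Suc i)"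
    by (rule dependent_nat_choice) (use later in blast)+
  then obtain r where r: "\<And>i. f (r i) \<in> A i" "\<And>i. r i < r (Suc i)"
    by blast
  have "limitin X (f \<circ> r) l sequentially"
    unfolding limitin_def
  proof (intro conjI allI impI l)
    fix V assume "openin X V \<and> l \<in> V"
    then obtain B where "B \<in> \<C>" "B \<subseteq> V"
      using base by (auto simp: \<C>_def)
    then obtain j where "from_nat_into \<C> j \<subseteq> V"
      using \<C> by (metis rangeE)
    then have "(f \<circ> r) i \<in> V" if "j \<le> i" for i
      using r(1)[of i] that by (auto simp: A_def)
    then show "\<forall>\<^sub>F i in sequentially. (f \<circ> r) i \<in> V"
      using eventually_sequentially by blast
  qed
  moreover have "strict_mono r"
    using r(2) by (simp add: strict_mono_Suc_iff)
  ultimately show thesis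
    using that by blast
qed

text \<open>Without a cluster point in \<open>S\<close>, every point of \<open>S\<close> has an open
  neighbourhood that \<open>f\<close> eventually avoids. Finitely many of these cover
  \<open>S\<close>, so some \<open>f n\<close> would lie outside \<open>S\<close>. A cluster point
  then gives a convergent subsequence by first countability.\<close>

lemma compactin_first_countable_convergent_subsequence:
  fixes f :: "nat \<Rightarrow> 'a"
  assumes "compactin X S" "first_countable X" and f: "\<And>n. f n \<in> S"
  obtains l and r :: "nat \<Rightarrow> nat"
    where "l \<in> S" "strict_mono r" "limitin X (f \<circ> r) l sequentially"
proof -
  have "\<exists>l\<in>S. \<forall>V. openin X V \<and> l \<in> V \<longrightarrow> (\<exists>\<^sub>F n in sequentially. f n \<in> V)"
  proof (rule ccontr)
    assume "\<not> ?thesis"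
    then have "\<forall>l\<in>S. \<exists>V. openin X V \<and> l \<in> V \<and> (\<forall>\<^sub>F n in sequentially. f n \<notin> V)"
      by (simp add: not_frequently)
    then have "S \<subseteq> \<Union>{V. openin X V \<and> (\<forall>\<^sub>F n in sequentially. f n \<notin> V)}"
      by blast
    then obtain \<F> where "finite \<F>" and S: "S \<subseteq> \<Union>\<F>"
      and \<F>: "\<F> \<subseteq> {V. openin X V \<and> (\<forall>\<^sub>F n in sequentially. f n \<notin> V)}"
      using \<open>compactin X S\<close> unfolding compactin_def by (metis (no_types, lifting) mem_Collect_eq)
    have "\<forall>\<^sub>F n in sequentially. \<forall>V\<in>\<F>. f n \<notin> V"
      using \<open>finite \<F>\<close> \<F> by (auto intro!: eventually_ball_finite)
    then obtain n where "\<forall>V\<in>\<F>. f n \<notin> V"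
      by (auto simp: eventually_sequentially)
    then show False
      using f[of n] S by blast
  qed
  then obtain l where "l \<in> S"
    and l: "\<And>V. openin X V \<Longrightarrow> l \<in> V \<Longrightarrow> \<exists>\<^sub>F n in sequentially. f n \<in> V"
    by blast
  moreover have "l \<in> topspace X"
    using \<open>l \<in> S\<close> assms(1) compactin_subset_topspace by blast
  ultimately show thesis
    using first_countable_convergent_subsequence[OF assms(2)] that by metis
qed

context group_action
begin

lemma orbit_eq:
  assumes "x \<in> E" "s \<in> carrier G"
  shows "orbit G \<phi> (\<phi> s x) = orbit G \<phi> x"
proof -
  have *: "\<phi> s x \<in> E" "\<phi> s x \<in> orbit G \<phi> x"
    using assms element_image by (auto simp: orbit_def)
  have sym: "x \<in> orbit G \<phi> (\<phi> s x)"
    by (rule orbit_sym[OF assms(1) *])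
  have sub: "y \<in> E" if "y \<in> orbit G \<phi> v" "v \<in> E" for y v
    using that element_image by (auto simp: orbit_def)
  show ?thesis
  proof (intro subset_antisym subsetI)
    fix y assume y: "y \<in> orbit G \<phi> (\<phi> s x)"
    show "y \<in> orbit G \<phi> x"
      by (rule orbit_trans[OF assms(1) *(1) sub[OF y *(1)] *(2) y])
  next
    fix y assume y: "y \<in> orbit G \<phi> x"
    show "y \<in> orbit G \<phi> (\<phi> s x)"
      by (rule orbit_trans[OF *(1) assms(1) sub[OF y assms(1)] sym y])
  qed
qed

end

context transformation_group
begin

lemma openin_translate:
  assumes "openin TG U" "r \<in> carrier G"
  shows "openin TG {k \<in> carrier G. k \<otimes> r \<in> U}"
proof -
  have "continuous_map TG (prod_topology TG TG) (\<lambda>k. (k, r))"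
    using assms(2) by (intro continuous_map_pairedI) (auto simp: topspace_group)
  then have "continuous_map TG TG (\<lambda>k. k \<otimes> r)"
    using continuous_map_compose[OF _ continuous_mult] by (force simp: o_def)
  from openin_continuous_map_preimage[OF this assms(1)] show ?thesis
    by (simp add: topspace_group)
qed

text \<open>A tube argument: the complement is the projection to \<open>X\<close> of the closed set
  of pairs \<open>(k, v)\<close> with \<open>\<phi> k v \<in> W\<close> and
  \<open>k \<notin> V\<close>, and projecting along the compact factor \<open>K\<close> is a closed
  map. It makes the condition on return times stable near a point, uniformly in
  \<open>k \<in> K\<close>.\<close>

lemma openin_return_times_subset:
  assumes K: "compactin TG K" and V: "openin TG V" and W: "closedin X W"
  shows "openin X {v \<in> topspace X. \<forall>k\<in>K. \<phi> k v \<in> W \<longrightarrow> k \<in> V}"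
proof -
  let ?K = "subtopology TG K"
  let ?P = "prod_topology ?K X"
  have Ksub: "K \<subseteq> carrier G"
    using K compactin_subset_topspace topspace_group by blast
  have "continuous_map ?P X (\<lambda>(k, v). \<phi> k v)"
    using continuous_action
    by (metis continuous_map_from_subtopology prod_topology_subtopology(1))
  then have 1: "closedin ?P {p \<in> topspace ?P. (\<lambda>(k, v). \<phi> k v) p \<in> W}"
    using W by (rule closedin_continuous_map_preimage)
  have "continuous_map ?P TG fst"
    using continuous_map_fst continuous_map_into_fulltopology by blast
  then have 2: "closedin ?P {p \<in> topspace ?P. fst p \<in> topspace TG - V}"
    using closedin_diff[OF closedin_topspace V] by (rule closedin_continuous_map_preimage)
  have "compact_space ?K"
    using K compact_space_subtopology by blast
  then have "closed_map ?P X snd"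
    by (rule closed_map_snd)
  then have "closedin X (snd ` ({p \<in> topspace ?P. (\<lambda>(k, v). \<phi> k v) p \<in> W} \<inter>
      {p \<in> topspace ?P. fst p \<in> topspace TG - V}))"
    using closedin_Int[OF 1 2] unfolding closed_map_def by blast
  then have "openin X (topspace X - snd ` ({p \<in> topspace ?P. (\<lambda>(k, v). \<phi> k v) p \<in> W} \<inter>
      {p \<in> topspace ?P. fst p \<in> topspace TG - V}))"
    by blast
  also have "topspace X - snd ` ({p \<in> topspace ?P. (\<lambda>(k, v). \<phi> k v) p \<in> W} \<inter>
      {p \<in> topspace ?P. fst p \<in> topspace TG - V})
      = {v \<in> topspace X. \<forall>k\<in>K. \<phi> k v \<in> W \<longrightarrow> k \<in> V}"
    using Ksub by (force simp: topspace_group)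
  finally show ?thesis .
qed

end

theorem lemma3p2:
  fixes G :: "('a, 'm) monoid_scheme" and TG :: "'a topology"
    and X :: "'x topology" and \<phi> :: "'a \<Rightarrow> 'x \<Rightarrow> 'x"
    and z :: 'x and W :: "'x set" and K U :: "'a set" and x :: "nat \<Rightarrow> 'x"
  assumes "second_countable_transformation_group G TG X \<phi>"
    and "z \<in> topspace X"
    and "compactin X W" and "z \<in> X interior_of W"
    and "compactin TG K"
    and "openin TG U" and "orbit_preimage G \<phi> z W \<subseteq> U"
    and "\<And>n. n \<ge> 1 \<Longrightarrow> x n \<in> topspace X"
    and "limitin (orbit_space G X \<phi>) (\<lambda>n. orbit G \<phi> (x n)) (orbit G \<phi> z) sequentially"
    and "\<And>\<sigma> l. strict_mono (\<sigma> :: nat \<Rightarrow> nat) \<Longrightarrow>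
           limitin (orbit_space G X \<phi>) (\<lambda>n. orbit G \<phi> (x (\<sigma> n))) l sequentially \<Longrightarrow>
           l = orbit G \<phi> z"
  shows "\<exists>n0\<ge>1. \<forall>n\<ge>n0. \<forall>s \<in> orbit_preimage G \<phi> (x n) W. \<exists>r \<in> orbit_preimage G \<phi> z W.
           (K #>\<^bsub>G\<^esub> s) \<inter> orbit_preimage G \<phi> (x n) W \<subseteq> (U #>\<^bsub>G\<^esub> inv\<^bsub>G\<^esub> r) #>\<^bsub>G\<^esub> s"
proof (rule ccontr)
  interpret second_countable_transformation_group G TG X \<phi> by fact
  define good where "good n s \<longleftrightarrow> (\<exists>r \<in> orbit_preimage G \<phi> z W.
    (K #>\<^bsub>G\<^esub> s) \<inter> orbit_preimage G \<phi> (x n) W \<subseteq> (U #>\<^bsub>G\<^esub> inv\<^bsub>G\<^esub> r) #>\<^bsub>G\<^esub> s)" for n s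
  \<comment> \<open>The bound \<open>n \<ge> 1\<close> matters because \<open>x 0\<close> is not
    assumed to be a point of \<open>X\<close>.\<close>
  define N where "N = {n. n \<ge> 1 \<and> (\<exists>s \<in> orbit_preimage G \<phi> (x n) W. \<not> good n s)}"
  assume "\<not> ?thesis"
  then have "\<forall>m\<ge>1. \<exists>n\<ge>m. n \<in> N"
    unfolding N_def good_def by fastforce
  then have "infinite N"
    unfolding infinite_nat_iff_unbounded_le by (meson le_trans nat_le_linear)
  then obtain \<sigma> :: "nat \<Rightarrow> nat" where \<sigma>: "strict_mono \<sigma>" "\<And>i. \<sigma> i \<in> N"
    using infinite_enumerate by blast
  then have "\<forall>i. \<exists>s. s \<in> orbit_preimage G \<phi> (x (\<sigma> i)) W \<and> \<not> good (\<sigma> i) s"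
    by (auto simp: N_def)
  then obtain s where s: "\<And>i. s i \<in> orbit_preimage G \<phi> (x (\<sigma> i)) W"
    and bad: "\<And>i. \<not> good (\<sigma> i) (s i)"
    by metis
  define v where "v i = \<phi> (s i) (x (\<sigma> i))" for i
  have sG: "s i \<in> carrier G" and vW: "v i \<in> W" for i
    using s by (auto simp: orbit_preimage_def v_def)
  have xX: "x (\<sigma> i) \<in> topspace X" for i
    using \<sigma>(2) assms(8) by (simp add: N_def)
  obtain l \<rho> where l: "l \<in> W" and \<rho>: "strict_mono \<rho>" and lim: "limitin X (v \<circ> \<rho>) l sequentially"
    using compactin_first_countable_convergent_subsequence[where f = v,
        OF assms(3) second_countable_imp_first_countable[OF second_countable_base] vW]
    by blast
  have lX: "l \<in> topspace X"
    using lim by (rule limitin_topspace)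
  \<comment> \<open>Moving \<open>x (\<sigma> i)\<close> to \<open>v i\<close> does not change its
    orbit, so continuity of the orbit map makes \<open>orbit G \<phi> l\<close> a limit of a
    subsequence of the given orbits.\<close>
  have "limitin (orbit_space G X \<phi>) (orbit G \<phi> \<circ> (v \<circ> \<rho>)) (orbit G \<phi> l) sequentially"
    using quotient_imp_continuous_map[OF quotient_map_orbit] lim by (rule continuous_map_limit)
  moreover have "orbit G \<phi> \<circ> (v \<circ> \<rho>) = (\<lambda>i. orbit G \<phi> (x ((\<sigma> \<circ> \<rho>) i)))"
    using orbit_eq xX sG by (auto simp: v_def)
  ultimately have "orbit G \<phi> l = orbit G \<phi> z"
    using assms(10)[OF strict_mono_o[OF \<sigma>(1) \<rho>]] by simp
  then obtain r where r: "r \<in> carrier G" "\<phi> r z = l"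
    using orbit_refl[OF lX] by (auto simp: orbit_def)
  then have rW: "r \<in> orbit_preimage G \<phi> z W"
    using l by (simp add: orbit_preimage_def)
  \<comment> \<open>Since \<open>l = \<phi> r z\<close>, the elements taking \<open>l\<close> into
    \<open>W\<close> are those taking \<open>z\<close> into \<open>W\<close>, translated on the
    right by the inverse of \<open>r\<close>. Hence \<open>V\<close>, the same translate of
    \<open>U\<close>, contains them.\<close>
  define V where "V = {k \<in> carrier G. k \<otimes>\<^bsub>G\<^esub> r \<in> U}"
  define O' where "O' = {v \<in> topspace X. \<forall>k\<in>K. \<phi> k v \<in> W \<longrightarrow> k \<in> V}"
  have KG: "K \<subseteq> carrier G" and UG: "U \<subseteq> carrier G"
    using assms(5,6) compactin_subset_topspace openin_subset topspace_group by blast+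
  have "k \<in> V" if "k \<in> K" "\<phi> k l \<in> W" for k
  proof -
    have k: "k \<in> carrier G"
      using that KG by blast
    then have "\<phi> (k \<otimes>\<^bsub>G\<^esub> r) z \<in> W"
      using that composition_rule[OF assms(2) _ r(1)] r(2) by simp
    then show ?thesis
      using k r(1) assms(7) by (auto simp: V_def orbit_preimage_def)
  qed
  then have "l \<in> O'"
    using lX by (simp add: O'_def)
  moreover have "openin X O'"
    unfolding O'_def V_def
    by (intro openin_return_times_subset openin_translate assms(5,6) r
        compactin_imp_closedin[OF Hausdorff_base assms(3)])
  \<comment> \<open>A single index suffices, since \<open>good\<close> fails at every
    \<open>\<sigma> i\<close>.\<close>
  ultimately obtain i where "v (\<rho> i) \<in> O'"
    using lim by (fastforce simp: limitin_def eventually_sequentially)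
  moreover define j where "j = \<rho> i"
  ultimately have vO: "\<And>k. k \<in> K \<Longrightarrow> \<phi> k (v j) \<in> W \<Longrightarrow> k \<in> V"
    by (simp add: O'_def)
  have "good (\<sigma> j) (s j)"
    unfolding good_def
  proof (intro bexI[OF _ rW] subsetI)
    fix t assume t: "t \<in> (K #>\<^bsub>G\<^esub> s j) \<inter> orbit_preimage G \<phi> (x (\<sigma> j)) W"
    then obtain k where k: "k \<in> K" "t = k \<otimes>\<^bsub>G\<^esub> s j"
      by (auto simp: r_coset_def)
    then have kG: "k \<in> carrier G"
      using KG by blast
    \<comment> \<open>The element \<open>t = k s\<close> moves \<open>x (\<sigma> j)\<close> to the
      point that \<open>k\<close> reaches from \<open>v j\<close>, so \<open>k\<close> is a return
      time of \<open>v j\<close> in \<open>K\<close>.\<close>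
    have "\<phi> k (v j) \<in> W"
      using t composition_rule[OF xX kG sG] by (simp add: k orbit_preimage_def v_def)
    then have "k \<otimes>\<^bsub>G\<^esub> r \<in> U"
      using vO k by (simp add: V_def)
    moreover have "k = (k \<otimes>\<^bsub>G\<^esub> r) \<otimes>\<^bsub>G\<^esub> inv\<^bsub>G\<^esub> r"
      using kG r(1) by (simp add: m_assoc)
    ultimately have "k \<in> U #>\<^bsub>G\<^esub> inv\<^bsub>G\<^esub> r"
      unfolding r_coset_def by blast
    then show "t \<in> (U #>\<^bsub>G\<^esub> inv\<^bsub>G\<^esub> r) #>\<^bsub>G\<^esub> s j"
      unfolding r_coset_def k(2) by blast
  qed
  then show False
    using bad by blast
qed

end
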